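(* Let $F$ be a field with $\operatorname{char}(F)\neq 2$ and let $L$ be an $n$-dimensional nilpotent Lie algebra over $F$ with $b(L)=1$. Then, for some integer $k\ge 1$ with $n-2k\ge 1$, $L$ has a basis $\{x_1,y_1,x_2,y_2,\ldots,x_k,y_k,z_1,z_2,\ldots,z_{n-2k}\}$ such that $[x_i,y_j]=\delta_{ij}z_1$ for all $1\le i,j\le k$, $[z_i,L]=0$ for all $1\le i\le n-2k$, and $[x_i,x_j]=0=[y_i,y_j]$ for all $1\le i,j\le k$.
   Context: For a finite dimensional Lie algebra $L$ and $x\in L$, $\operatorname{ad}_x:L\to L$ denotes the map $y\mapsto [x,y]$. The breadth of $L$ is $b(L)=\max\{\operatorname{rank}(\operatorname{ad}_x)\mid x\in L\}$. Here $\delta_{ij}$ is the Kronecker delta. *)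

theory Defs
  imports Complex_Main
begin

text \<open>A Lie algebra over the field \<open>'f\<close> has a whole type \<open>'l\<close> as its carrier.\<close>

locale lie_algebra = vector_space scale
  for scale :: "'f::field \<Rightarrow> 'l::ab_group_add \<Rightarrow> 'l" +
  fixes bracket :: "'l \<Rightarrow> 'l \<Rightarrow> 'l"
  assumes linear_bracket_left: "Vector_Spaces.linear scale scale (\<lambda>x. bracket x y)"
    and linear_bracket_right: "Vector_Spaces.linear scale scale (\<lambda>y. bracket x y)"
    and bracket_self: "bracket x x = 0"
    and jacobi: "bracket x (bracket y z) + bracket y (bracket z x) + bracket z (bracket x y) = 0"
begin

definition finite_dim :: bool
  where "finite_dim \<longleftrightarrow> (\<exists>B. finite B \<and> span B = UNIV)"

definition ad :: "'l \<Rightarrow> 'l \<Rightarrow> 'l"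
  where "ad x = (\<lambda>y. bracket x y)"

text \<open>Meaningful for finite-dimensional algebras only: otherwise \<open>dim\<close> may be the
  cardinality of an infinite set, i.e. 0, and the set of ranks may be infinite.\<close>

definition breadth :: nat
  where "breadth = Max {dim (range (ad x)) | x. True}"

text \<open>The product of two subsets is the linear span of all brackets, not just the set of brackets.\<close>

definition bracket_span :: "'l set \<Rightarrow> 'l set \<Rightarrow> 'l set"
  where "bracket_span A B = span {bracket a b | a b. a \<in> A \<and> b \<in> B}"

primrec lower_central :: "nat \<Rightarrow> 'l set" where
  "lower_central 0 = UNIV"
| "lower_central (Suc m) = bracket_span UNIV (lower_central m)"

definition nilpotent :: bool
  where "nilpotent \<longleftrightarrow> (\<exists>m. lower_central m = {0})"

text \<open>A list rather than a set, so that a repeated vector is excluded.\<close>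

definition is_basis :: "'l list \<Rightarrow> bool"
  where "is_basis bs \<longleftrightarrow> distinct bs \<and> independent (set bs) \<and> span (set bs) = UNIV"

end

end

theory Submission
  imports Defs
begin

text \<open>Breadth one makes the derived algebra a line. Suppose \<open>[x, y] = u \<noteq> 0\<close>. All \<open>ad\<close> maps have
  rank at most one, so any nonzero value of \<open>ad a\<close> spans its image; in
  particular \<open>x\<close> and \<open>y\<close> bracket everything into the line through \<open>u\<close>. For an arbitrary \<open>a\<close>, if
  \<open>[a, y] \<noteq> 0\<close> then \<open>ad a\<close> takes a nonzero value on that line and hence has all its values there;
  otherwise \<open>[a + x, y] = u\<close>, so \<open>a + x\<close> brackets into the line, and so does \<open>a = (a + x) - x\<close>
  (\<open>bracket_in_span_singleton\<close>). Nilpotency makes \<open>u\<close> central, because a relation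
  \<open>[a, u] = c u\<close> with \<open>c \<noteq> 0\<close> would keep \<open>u\<close> in every term of the lower central series
  (\<open>nilpotent_bracket_eigenvector\<close>).

  Consequently \<open>[a, b] = \<beta>(a, b) u\<close> for an alternating bilinear form \<open>\<beta>\<close> whose radical is the
  centre, and the theorem becomes the symplectic normal form of a possibly degenerate alternating
  form. A hyperbolic system \<open>x\<^sub>1, y\<^sub>1, \<dots>, x\<^sub>k, y\<^sub>k\<close> of largest size exists by finite dimension;
  subtracting from a vector its component along the system leaves a vector of the radical, since two
  vectors orthogonal to the system and not to each other would enlarge it
  (\<open>exists_hyperbolic_modulo_radical\<close>). Adding a basis of the radical that starts with
  \<open>u\<close> completes the system to a basis of the whole space.\<close>

section \<open>Alternating bilinear forms\<close>

locale alternating_form = vector_space scale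
  for scale :: "'f::field \<Rightarrow> 'l::ab_group_add \<Rightarrow> 'l" (infixr "*s" 75) +
  fixes form :: "'l \<Rightarrow> 'l \<Rightarrow> 'f"
  assumes form_add_left: "form (a + b) w = form a w + form b w"
    and form_add_right: "form w (a + b) = form w a + form w b"
    and form_scale_left: "form (c *s a) w = c * form a w"
    and form_scale_right: "form w (c *s a) = c * form w a"
    and form_self: "form a a = 0"
begin

lemma form_zero_left [simp]: "form 0 w = 0"
  using form_scale_left[of 0 0 w] by simp

lemma form_zero_right [simp]: "form w 0 = 0"
  using form_scale_right[of w 0 0] by simp

lemma form_skew: "form a b = - form b a"
proof -
  have "form (a + b) (a + b) = form a b + form b a"
    unfolding form_add_left form_add_right by (simp add: form_self)
  then show ?thesis by (simp add: form_self eq_neg_iff_add_eq_0)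
qed

lemma form_diff_left: "form (a - b) w = form a w - form b w"
  using form_add_left[of "a - b" b w] by simp

lemma form_sum_left: "form (sum f A) w = (\<Sum>i\<in>A. form (f i) w)"
  by (induction A rule: infinite_finite_induct) (simp_all add: form_add_left)

lemma subspace_orthogonal: "subspace {v. form v w = 0}"
  by (rule subspaceI) (simp_all add: form_add_left form_scale_left)

definition radical :: "'l set"
  where "radical = {v. \<forall>w. form v w = 0}"

lemma radicalD: "v \<in> radical \<Longrightarrow> form v w = 0" "v \<in> radical \<Longrightarrow> form w v = 0"
  using form_skew[of w v] by (auto simp: radical_def)

definition hyperbolic :: "nat \<Rightarrow> (nat \<Rightarrow> 'l) \<Rightarrow> (nat \<Rightarrow> 'l) \<Rightarrow> bool"
  where "hyperbolic k x y \<longleftrightarrow> (\<forall>i\<in>{1..k}. \<forall>j\<in>{1..k}.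
    form (x i) (y j) = (if i = j then 1 else 0) \<and> form (x i) (x j) = 0 \<and> form (y i) (y j) = 0)"

abbreviation pairs :: "nat \<Rightarrow> (nat \<Rightarrow> 'l) \<Rightarrow> (nat \<Rightarrow> 'l) \<Rightarrow> 'l list"
  where "pairs k x y \<equiv> concat (map (\<lambda>i. [x i, y i]) [1..<Suc k])"

lemma set_pairs: "set (pairs k x y) = (\<Union>i\<in>{1..k}. {x i, y i})"
  by (simp add: atLeastLessThanSuc_atLeastAtMost del: upt_Suc)

lemma length_pairs: "length (pairs k x y) = 2 * k"
  by (induction k) simp_all

text \<open>In passing from \<open>k\<close> to \<open>Suc k\<close>, neither new vector lies in the span of the vectors before it:
  its partner in the pair is orthogonal to all of these, hence to their span, but not to
  the new vector itself.\<close>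

lemma hyperbolic_independent:
  assumes "hyperbolic k x y" "distinct zs" "independent (set zs)" "set zs \<subseteq> radical"
  shows "distinct (pairs k x y @ zs) \<and> independent (set (pairs k x y @ zs))"
  using assms(1)
proof (induction k)
  case 0
  then show ?case using assms by simp
next
  case (Suc k)
  have hyp: "hyperbolic k x y" using Suc.prems by (auto simp: hyperbolic_def)
  let ?S = "set (pairs k x y @ zs)" and ?a = "x (Suc k)" and ?b = "y (Suc k)"
  have IH: "distinct (pairs k x y @ zs)" "independent ?S" using Suc.IH[OF hyp] by auto
  have orth: "form v w = 0" if "v \<in> span T" "\<And>t. t \<in> T \<Longrightarrow> form t w = 0" for v w T
    using span_minimal[OF _ subspace_orthogonal[of w], of T] that by auto
  have ab: "form ?a ?b = 1" "form ?b ?a = - 1"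
    using Suc.prems form_skew[of ?b ?a] by (auto simp: hyperbolic_def)
  have old: "form t ?b = 0" "form t ?a = 0" if "t \<in> ?S" for t
  proof -
    have "form (x i) ?b = 0 \<and> form (y i) ?b = 0 \<and> form (x i) ?a = 0 \<and> form (y i) ?a = 0"
      if "i \<in> {1..k}" for i
      using Suc.prems that form_skew[of "y i" ?a] by (simp add: hyperbolic_def)
    then have *: "form t ?b = 0 \<and> form t ?a = 0" if "t \<in> set (pairs k x y)" for t
      using that unfolding set_pairs by auto
    have "t \<in> set (pairs k x y) \<or> t \<in> radical" using that assms(4) by auto
    then show "form t ?b = 0" "form t ?a = 0" using * radicalD by auto
  qed
  have a: "?a \<notin> span ?S" using orth[of ?a ?S ?b] old ab by auto
  have b: "?b \<notin> span (insert ?a ?S)"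
    using orth[of ?b "insert ?a ?S" ?a] old ab form_self by auto
  have "independent (insert ?b (insert ?a ?S))"
    by (intro independent_insertI IH a b)
  moreover have "set (pairs (Suc k) x y @ zs) = insert ?b (insert ?a ?S)" by auto
  moreover have "distinct (pairs (Suc k) x y @ zs)"
  proof -
    have "?a \<notin> ?S" "?b \<notin> insert ?a ?S" using a b span_base by blast+
    then show ?thesis using IH(1) by auto
  qed
  ultimately show ?case by simp
qed

definition component :: "nat \<Rightarrow> (nat \<Rightarrow> 'l) \<Rightarrow> (nat \<Rightarrow> 'l) \<Rightarrow> 'l \<Rightarrow> 'l"
  where "component k x y v = (\<Sum>i=1..k. form v (y i) *s x i - form v (x i) *s y i)"

lemma component_in_span: "component k x y v \<in> span (set (pairs k x y))"
  unfolding component_def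
  by (intro span_sum span_diff span_scale span_base; unfold set_pairs; blast)

lemma minus_component_orthogonal:
  assumes "hyperbolic k x y" "j \<in> {1..k}"
  shows "form (v - component k x y v) (x j) = 0" "form (v - component k x y v) (y j) = 0"
proof -
  have yx: "form (y i) (x j) = (if i = j then - 1 else 0)" if "i \<in> {1..k}" for i
    using assms that form_skew[of "y i" "x j"] by (auto simp: hyperbolic_def)
  have "form (component k x y v) (x j) = (\<Sum>i=1..k. if i = j then form v (x j) else 0)"
    unfolding component_def form_sum_left form_diff_left form_scale_left
    using assms yx by (intro sum.cong) (auto simp: hyperbolic_def)
  then show "form (v - component k x y v) (x j) = 0"
    using assms(2) by (simp add: form_diff_left)
  have "form (component k x y v) (y j) = (\<Sum>i=1..k. if i = j then form v (y j) else 0)"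
    unfolding component_def form_sum_left form_diff_left form_scale_left
    using assms by (intro sum.cong) (auto simp: hyperbolic_def)
  then show "form (v - component k x y v) (y j) = 0"
    using assms(2) by (simp add: form_diff_left)
qed

text \<open>The size of a hyperbolic system is bounded by the dimension, so a largest one exists. If
  vectors \<open>a\<close>, \<open>b\<close> orthogonal to it satisfied \<open>form a b \<noteq> 0\<close>, then \<open>a\<close> and a multiple of \<open>b\<close>
  would be a further pair. Thus the orthogonal complement of the system is totally isotropic, and as it
  spans the space together with the system, it is the radical.\<close>

lemma exists_hyperbolic_modulo_radical:
  assumes "finite S" "span S = UNIV"
  obtains k x y where "hyperbolic k x y" "\<forall>v. v - component k x y v \<in> radical"
proof -
  let ?P = "\<lambda>k. \<exists>x y. hyperbolic k x y"
  have bound: "k < Suc (card S)" if "?P k" for k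
  proof -
    from that obtain x y where "hyperbolic k x y" by auto
    from hyperbolic_independent[where zs = "[]", OF this]
    have d: "distinct (pairs k x y)" "independent (set (pairs k x y))"
      by (simp_all add: independent_empty)
    have "card (set (pairs k x y)) \<le> card S"
      using independent_span_bound[OF assms(1) d(2)] assms(2) by simp
    then show ?thesis using distinct_card[OF d(1)] length_pairs[of x y k] by linarith
  qed
  have "?P 0" by (simp add: hyperbolic_def)
  then obtain k where "?P k" and max: "\<And>m. ?P m \<Longrightarrow> m \<le> k"
    using ex_has_greatest_nat[of ?P 0 "\<lambda>k. k" "Suc (card S)"] bound by blast
  then obtain x y where hyp: "hyperbolic k x y" by auto
  have iso: "form a b = 0"
    if a: "\<And>j. j \<in> {1..k} \<Longrightarrow> form a (x j) = 0 \<and> form a (y j) = 0"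
      and b: "\<And>j. j \<in> {1..k} \<Longrightarrow> form b (x j) = 0 \<and> form b (y j) = 0" for a b
  proof (rule ccontr)
    assume ne: "form a b \<noteq> 0"
    define b' where "b' = (1 / form a b) *s b"
    have ab': "form a b' = 1" using ne by (simp add: b'_def form_scale_right)
    have b': "form b' (x j) = 0 \<and> form b' (y j) = 0" if "j \<in> {1..k}" for j
      using b[OF that] by (simp add: b'_def form_scale_left)
    have sym: "form (x j) a = 0 \<and> form (y j) a = 0 \<and> form (x j) b' = 0 \<and> form (y j) b' = 0"
      if "j \<in> {1..k}" for j
      using a[OF that] b'[OF that] form_skew[of "x j"] form_skew[of "y j"] by simp
    have "hyperbolic (Suc k) (x(Suc k := a)) (y(Suc k := b'))"
      using hyp a b' ab' sym unfolding hyperbolic_def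
      by (auto simp: atLeastAtMostSuc_conv form_self)
    then show False using max[of "Suc k"] by auto
  qed
  have "v - component k x y v \<in> radical" for v
    unfolding radical_def
  proof safe
    fix w
    let ?v = "v - component k x y v"
    have v: "form ?v (x j) = 0 \<and> form ?v (y j) = 0" if "j \<in> {1..k}" for j
      using minus_component_orthogonal[OF hyp that] by simp
    have "form ?v (w - component k x y w) = 0"
      using minus_component_orthogonal[OF hyp] by (intro iso v) auto
    moreover have "form (component k x y w) ?v = 0"
    proof -
      have "form t ?v = 0" if "t \<in> set (pairs k x y)" for t
        using that v form_skew[of t ?v] unfolding set_pairs by auto
      then have "span (set (pairs k x y)) \<subseteq> {t. form t ?v = 0}"
        by (intro span_minimal subspace_orthogonal) auto
      then show ?thesis using component_in_span[of k x y w] by blast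
    qed
    ultimately show "form ?v w = 0"
      using form_add_right[of ?v "w - component k x y w" "component k x y w"]
        form_skew[of ?v "component k x y w"] by simp
  qed
  then show ?thesis using that hyp by blast
qed

text \<open>The radical part of the basis can start with any prescribed nonzero vector \<open>u\<close>. For a Lie
  algebra whose bracket is \<open>form\<close> times a central vector, this vector is the choice for \<open>u\<close>.\<close>

theorem symplectic_basis:
  assumes "finite S" "span S = UNIV" "u \<in> radical" "u \<noteq> 0"
  obtains k x y zs where "hyperbolic k x y" "set (u # zs) \<subseteq> radical"
    "distinct (pairs k x y @ u # zs)" "independent (set (pairs k x y @ u # zs))"
    "span (set (pairs k x y @ u # zs)) = UNIV"
proof -
  obtain k x y where hyp: "hyperbolic k x y" and rad: "\<forall>v. v - component k x y v \<in> radical"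
    by (rule exists_hyperbolic_modulo_radical[OF assms(1,2)])
  have "independent {u}"
    using assms(4) by simp
  then obtain B where B: "{u} \<subseteq> B" "B \<subseteq> radical" "independent B" "radical \<subseteq> span B"
    using maximal_independent_subset_extend[of "{u}" radical] assms(3) by auto
  have "finite B" using independent_span_bound[OF assms(1) B(3)] assms(2) by simp
  then obtain zs where zs: "set zs = B - {u}" "distinct zs"
    using finite_distinct_list[of "B - {u}"] by auto
  have set: "set (u # zs) = B" using zs(1) B(1) by auto
  let ?L = "pairs k x y @ u # zs"
  have ind: "distinct ?L \<and> independent (set ?L)"
    using zs B(2,3) by (intro hyperbolic_independent[OF hyp]) (simp, unfold set)
  have "v \<in> span (set ?L)" for v
  proof -
    have "v - component k x y v \<in> span (set ?L)"
    proof -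
      have "B \<subseteq> set ?L" using set by auto
      then show ?thesis using spec[OF rad, of v] B(4) span_mono by blast
    qed
    moreover have "component k x y v \<in> span (set ?L)"
    proof -
      have "set (pairs k x y) \<subseteq> set ?L" unfolding set_append by (rule Un_upper1)
      then show ?thesis using component_in_span[of k x y v] span_mono by blast
    qed
    ultimately have "(v - component k x y v) + component k x y v \<in> span (set ?L)"
      by (rule span_add)
    then show ?thesis by (simp only: diff_add_cancel)
  qed
  then have "span (set ?L) = UNIV" by blast
  moreover have "set (u # zs) \<subseteq> radical" unfolding set by (rule B(2))
  ultimately show ?thesis using ind by (intro that[OF hyp]) blast+
qed

end

section \<open>Lie algebras of breadth one\<close>

context lie_algebra
begin

lemma bracket_add_left: "bracket (a + b) w = bracket a w + bracket b w"
  using module_hom.add[OF Vector_Spaces.linear.axioms(3)[OF linear_bracket_left]] .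

lemma bracket_add_right: "bracket w (a + b) = bracket w a + bracket w b"
  using module_hom.add[OF Vector_Spaces.linear.axioms(3)[OF linear_bracket_right]] .

lemma bracket_scale_left: "bracket (scale c a) w = scale c (bracket a w)"
  using module_hom.scale[OF Vector_Spaces.linear.axioms(3)[OF linear_bracket_left]] .

lemma bracket_scale_right: "bracket w (scale c a) = scale c (bracket w a)"
  using module_hom.scale[OF Vector_Spaces.linear.axioms(3)[OF linear_bracket_right]] .

lemma bracket_skew: "bracket a b = - bracket b a"
proof -
  have "bracket (a + b) (a + b) = bracket a b + bracket b a"
    unfolding bracket_add_left bracket_add_right by (simp add: bracket_self)
  then show ?thesis by (simp add: bracket_self eq_neg_iff_add_eq_0)
qed

lemma finite_ranks:
  assumes "finite_dim"
  shows "finite {dim (range (ad a)) | a. True}"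
proof -
  obtain S where S: "finite S" "span S = UNIV" using assms finite_dim_def by auto
  have "{dim (range (ad a)) | a. True} \<subseteq> {..card S}"
    using dim_le_card[of _ S] S by auto
  then show ?thesis using finite_subset by blast
qed

lemma bracket_nonzero_if_breadth_nonzero:
  assumes "finite_dim" "breadth \<noteq> 0"
  obtains x y where "bracket x y \<noteq> 0"
proof (rule ccontr)
  assume "\<not> thesis"
  then have zero: "\<And>x y. bracket x y = 0" using that by blast
  have "dim (range (ad a)) = 0" for a
    using dim_le_card[of "range (ad a)" "{}"] by (auto simp: ad_def zero)
  then have "breadth = 0" unfolding breadth_def by simp
  then show False using assms by simp
qed

lemma bracket_in_span_of_nonzero_bracket:
  assumes "finite_dim" "breadth \<le> 1" "bracket a b \<noteq> 0"
  shows "bracket a w \<in> span {bracket a b}"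
proof (rule ccontr)
  assume "bracket a w \<notin> span {bracket a b}"
  moreover have "independent {bracket a b}"
    using assms(3) by simp
  ultimately have ind: "independent {bracket a w, bracket a b}" by (rule independent_insertI)
  obtain S where S: "finite S" "span S = UNIV" using assms(1) finite_dim_def by auto
  obtain B where B: "B \<subseteq> range (ad a)" "independent B" "range (ad a) \<subseteq> span B"
    "card B = dim (range (ad a))"
    using basis_exists by metis
  have "finite B" using independent_span_bound[OF S(1) B(2)] S(2) by simp
  have "card B \<le> breadth"
    unfolding breadth_def B(4) using finite_ranks[OF assms(1)] by (intro Max_ge) auto
  moreover have "card {bracket a w, bracket a b} \<le> card B"
    using independent_span_bound[OF \<open>finite B\<close> ind] B(3) by (auto simp: ad_def)
  moreover have "card {bracket a w, bracket a b} = 2"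
    using \<open>bracket a w \<notin> span {bracket a b}\<close> span_base[of "bracket a b" "{bracket a b}"]
    by (auto simp: card_insert_if)
  ultimately show False using assms(2) by simp
qed

text \<open>In a linear space of maps of rank at most one, either all images lie in one line or all maps
  vanish on a common hyperplane. For the maps \<open>ad a\<close> the second alternative is impossible: a
  hyperplane of central vectors leaves only multiples of one further vector, which commute with each
  other. Skew symmetry turns this dichotomy into a short argument: \<open>ad x\<close> and \<open>ad y\<close> share
  the image line, and every \<open>ad a\<close>, possibly after adding \<open>ad x\<close>, has a nonzero value at \<open>y\<close>.\<close>

lemma bracket_in_span_singleton:
  assumes "finite_dim" "breadth \<le> 1" "bracket x y \<noteq> 0"
  shows "bracket a b \<in> span {bracket x y}"
proof -
  let ?u = "bracket x y"
  note line = bracket_in_span_of_nonzero_bracket[OF assms(1,2)]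
  have x: "bracket x w \<in> span {?u}" for w using line assms(3) by blast
  have y: "bracket w y \<in> span {?u}" for w
  proof -
    have "bracket y w \<in> span {bracket y x}"
      using assms(3) bracket_skew[of x y] by (intro line) auto
    also have "span {bracket y x} \<subseteq> span {?u}"
      using bracket_skew[of y x] span_neg[OF span_base, of ?u "{?u}"]
      by (intro span_minimal) auto
    finally show ?thesis using bracket_skew[of w y] span_neg by metis
  qed
  show ?thesis
  proof (cases "bracket a y = 0")
    case True
    then have "bracket (a + x) y = ?u" by (simp add: bracket_add_left)
    then have "bracket (a + x) b \<in> span {?u}" using line[of "a + x" y b] assms(3) by simp
    then have "bracket (a + x) b - bracket x b \<in> span {?u}" using x span_diff by blast
    then show ?thesis by (simp add: bracket_add_left)
  next
    case False
    then have "bracket a b \<in> span {bracket a y}" by (rule line)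
    also have "span {bracket a y} \<subseteq> span {?u}" using y by (intro span_minimal) auto
    finally show ?thesis .
  qed
qed

lemma nilpotent_bracket_eigenvector:
  assumes "nilpotent" "bracket a u = scale c u" "u \<noteq> 0"
  shows "c = 0"
proof (rule ccontr)
  assume c: "c \<noteq> 0"
  have "u \<in> lower_central m" for m
  proof (induction m)
    case (Suc m)
    have "bracket a u \<in> lower_central (Suc m)"
      using Suc by (auto simp: bracket_span_def intro!: span_base)
    then have "scale (1 / c) (bracket a u) \<in> lower_central (Suc m)"
      by (simp add: bracket_span_def span_scale)
    then show ?case using c by (simp add: assms(2))
  qed simp
  then show False using assms unfolding nilpotent_def by blast
qed

text \<open>Bilinearity of the coordinate with respect to \<open>u\<close> is inherited from the bracket, because the
  coordinate is unique for \<open>u \<noteq> 0\<close>.\<close>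

lemma exists_alternating_form:
  assumes "u \<noteq> 0" "\<And>a b. bracket a b \<in> span {u}"
  obtains form where "alternating_form scale form" "\<And>a b. bracket a b = scale (form a b) u"
proof -
  have "\<forall>a b. \<exists>c. bracket a b = scale c u" using assms(2) by (auto simp: span_singleton)
  then obtain form where form: "\<And>a b. bracket a b = scale (form a b) u" by metis
  have inj: "c = d" if "scale c u = scale d u" for c d using that assms(1) by simp
  have "alternating_form scale form"
  proof unfold_locales
    fix a b w c
    show "form (a + b) w = form a w + form b w"
      by (rule inj) (simp add: scale_left_distrib form[symmetric] bracket_add_left)
    show "form w (a + b) = form w a + form w b"
      by (rule inj) (simp add: scale_left_distrib form[symmetric] bracket_add_right)
    show "form (scale c a) w = c * form a w"
      by (rule inj) (simp add: scale_scale[symmetric] form[symmetric] bracket_scale_left del: scale_scale)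
    show "form w (scale c a) = c * form w a"
      by (rule inj) (simp add: scale_scale[symmetric] form[symmetric] bracket_scale_right del: scale_scale)
    show "form a a = 0"
      by (rule inj) (simp add: form[symmetric] bracket_self)
  qed
  then show ?thesis using that form by blast
qed

end

theorem theorem2p5:
  fixes scale :: "'f::field \<Rightarrow> 'l::ab_group_add \<Rightarrow> 'l"
    and bracket :: "'l \<Rightarrow> 'l \<Rightarrow> 'l"
    and n :: nat
  assumes "CHAR('f) \<noteq> 2"
    and "lie_algebra scale bracket"
    and "lie_algebra.finite_dim scale"
    and "vector_space.dim scale (UNIV :: 'l set) = n"
    and "lie_algebra.nilpotent scale bracket"
    and "lie_algebra.breadth scale bracket = 1"
  shows "\<exists>(k::nat) (x :: nat \<Rightarrow> 'l) (y :: nat \<Rightarrow> 'l) (z :: nat \<Rightarrow> 'l).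
      k \<ge> 1 \<and> n - 2 * k \<ge> 1 \<and>
      lie_algebra.is_basis scale
        (concat (map (\<lambda>i. [x i, y i]) [1..<Suc k]) @ map z [1..<Suc (n - 2 * k)]) \<and>
      (\<forall>i\<in>{1..k}. \<forall>j\<in>{1..k}. bracket (x i) (y j) = (if i = j then z 1 else 0)) \<and>
      (\<forall>i\<in>{1..n - 2 * k}. \<forall>w. bracket (z i) w = 0) \<and>
      (\<forall>i\<in>{1..k}. \<forall>j\<in>{1..k}. bracket (x i) (x j) = 0 \<and> bracket (y i) (y j) = 0)"
proof -
  interpret lie_algebra scale bracket by fact
  note fin = \<open>lie_algebra.finite_dim scale\<close>
  obtain S where S: "finite S" "span S = UNIV" using fin finite_dim_def by auto
  obtain x0 y0 where u0: "bracket x0 y0 \<noteq> 0"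
    using bracket_nonzero_if_breadth_nonzero fin assms(6) by auto
  define u where "u = bracket x0 y0"
  have u: "u \<noteq> 0" using u0 by (simp add: u_def)
  have "bracket a b \<in> span {u}" for a b
    unfolding u_def using fin assms(6) u0 by (intro bracket_in_span_singleton) simp_all
  then obtain form where alt: "alternating_form scale form"
    and form: "\<And>a b. bracket a b = scale (form a b) u"
    using exists_alternating_form u by blast
  interpret alternating_form scale form by (rule alt)
  have "form a u = 0" for a
    using nilpotent_bracket_eigenvector[OF assms(5) form u] .
  then have u_rad: "u \<in> radical" using form_skew[of u] by (simp add: radical_def)
  obtain k x y zs where hyp: "hyperbolic k x y" and rad: "set (u # zs) \<subseteq> radical"
    and basis: "distinct (pairs k x y @ u # zs)" "independent (set (pairs k x y @ u # zs))"
      "span (set (pairs k x y @ u # zs)) = UNIV"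
    by (rule symplectic_basis[OF S u_rad u])
  have "card (set (pairs k x y @ u # zs)) = n"
    using dim_unique[OF subset_UNIV _ basis(2) refl] basis(3) assms(4) by (metis order_refl)
  then have n: "n = 2 * k + length (u # zs)"
    using distinct_card[OF basis(1)] length_pairs[of x y k] by simp
  \<comment> \<open>Without any pair the radical would be everything, and all brackets would vanish.\<close>
  have "k \<noteq> 0"
  proof
    assume "k = 0"
    then have "span (set (u # zs)) = UNIV" using basis(3) by simp
    moreover have "span (set (u # zs)) \<subseteq> {v. form v y0 = 0}"
      using rad radicalD(1) by (intro span_minimal subspace_orthogonal) blast
    ultimately have "form x0 y0 = 0" by auto
    then show False using form[of x0 y0] u0 by simp
  qed
  define z where "z i = (u # zs) ! (i - 1)" for i
  have z: "map z [1..<Suc (n - 2 * k)] = u # zs"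
    by (rule nth_equalityI) (simp_all add: n z_def del: upt_Suc)
  have central: "bracket (z i) w = 0" if "i \<in> {1..n - 2 * k}" for i w
  proof -
    have "z i \<in> set (u # zs)" unfolding z_def using that n by (intro nth_mem) auto
    then show ?thesis using rad radicalD(1) form by auto
  qed
  have "z 1 = u" by (simp add: z_def)
  have "is_basis (pairs k x y @ map z [1..<Suc (n - 2 * k)])"
    unfolding z is_basis_def using basis by blast
  moreover have "bracket (x i) (y j) = (if i = j then z 1 else 0)"
    "bracket (x i) (x j) = 0 \<and> bracket (y i) (y j) = 0" if "i \<in> {1..k}" "j \<in> {1..k}" for i j
    using hyp that form \<open>z 1 = u\<close> unfolding hyperbolic_def by auto
  moreover have "k \<ge> 1" "n - 2 * k \<ge> 1" using \<open>k \<noteq> 0\<close> n by simp_all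
  ultimately show ?thesis
    using central
    by - (rule exI[of _ k], rule exI[of _ x], rule exI[of _ y], rule exI[of _ z],
      intro conjI ballI allI; simp only:)
qed

end
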